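(* Let $1\le k<d$ and $t\ge1$. (i) For every $\alpha\in\mathbb{N}^d$ with $|\alpha|=t$ there are real coefficients $a^\alpha_\beta$ ($|\beta|\le t$), which make the identity $\mathbb{E}X^\alpha=\sum_{|\beta|\le t}a^\alpha_\beta\sum_j\omega_j\mathbb{E}(P_jX)^\beta$ valid for every exact cubature $\{(P_j,\omega_j)\}$ for $\mathrm{Pol}^2_t(\mathcal{G}_{k,d})$ and every random vector $X$ in $\mathbb{S}^{d-1}$, and a constant $c_\alpha\ge0$, such that for every $\epsilon\ge0$, every $\epsilon$-approximate cubature $\{(P_j,\omega_j)\}_{j=1}^n$ for $\mathrm{Pol}_t(\mathcal{G}_{k,d})$ with respect to $K_t$ and every random vector $X$ with values in $\mathbb{S}^{d-1}$, $$\Big|\mathbb{E}X^\alpha-\sum_{|\beta|\le t}a^\alpha_\beta\sum_{j=1}^n\omega_j\mathbb{E}(P_jX)^\beta\Big|\le\epsilon\,c_\alpha.$$ (ii) If $k=1$ and $t\le d$, then for every $\alpha\in\mathbb{N}^d$ with $|\alpha|=t$ there are real coefficients $a^\alpha_\beta$ ($|\beta|=t$), which make the identity $\mathbb{E}X^\alpha=\sum_{|\beta|=t}a^\alpha_\beta\sum_j\omega_j\mathbb{E}(P_jX)^\beta$ valid for every exact cubature for $\mathrm{Pol}^3_t(\mathcal{G}_{1,d})$, and a constant $c\ge0$, such that for every $\epsilon$-approximate cubature $\{(P_j,\omega_j)\}_{j=1}^n$ for $\mathrm{Pol}_t(\mathcal{G}_{1,d})$ with respect to $K_t$ and every random vector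 $X$ in $\mathbb{R}^d$ with $\mathbb{E}\|X\|^t<\infty$, $$\Big|\mathbb{E}X^\alpha-\sum_{|\beta|=t}a^\alpha_\beta\sum_{j=1}^n\omega_j\mathbb{E}(P_jX)^\beta\Big|\le c\,\epsilon\,\mathbb{E}\|X\|^t.$$
   Context: $\mathscr{H}_d$ denotes the real symmetric $d\times d$ matrices with $\langle A,B\rangle=\operatorname{trace}(AB)$. $\mathcal{G}_{k,d}=\{P\in\mathscr{H}_d:P^2=P,\ \operatorname{trace}(P)=k\}$, with orthogonally invariant Borel probability measure $\sigma_{k,d}$. $\mathrm{Pol}_t(\mathcal{G}_{k,d})$ is the space of restrictions to $\mathcal{G}_{k,d}$ of polynomials of degree at most $t$ on $\mathscr{H}_d$; $\mathrm{Pol}^\ell_t(\mathcal{G}_{k,d})$ is the span of $P\mapsto\langle M,P\rangle^s$ with $\operatorname{rank}M\le\ell$, $s\le t$. An (exact) cubature for a space $V$ is a family $\{(P_j,\omega_j)\}$, $P_j\in\mathcal{G}_{k,d}$, $\omega_j\in\mathbb{R}$, with $\sum_j\omega_jf(P_j)=\int f\,d\sigma_{k,d}$ for all $f\in V$. $K_t(P,Q)=\langle P,Q\rangle^t$; it induces the norm $\|f\|_{K_t}^2=\sum_{i,j}c_ic_jK_t(Q_i,Q_j)$ on $\mathrm{Pol}_t(\mathcal{G}_{k,d})$ for $f=\sum_ic_iK_t(Q_i,\cdot)$. A family $\{(P_j,\omega_j)\}$ is an $\epsilon$-approximate cubature for $\mathrm{Pol}_t(\mathcal{G}_{k,d})$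 with respect to $K_t$ if $|\sum_j\omega_jf(P_j)-\int f\,d\sigma_{k,d}|\le\epsilon$ for all $f\in\mathrm{Pol}_t(\mathcal{G}_{k,d})$ with $\|f\|_{K_t}=1$. Multi-index notation: $X^\alpha=X_1^{\alpha_1}\cdots X_d^{\alpha_d}$ and $(P_jX)^\beta$ the corresponding power of $P_jX$. The constants may depend on $\alpha,k,d$. *)

theory Defs
  imports "HOL-Probability.Probability"
begin

type_synonym 'd mat = "real^'d^'d"

definition symm_mat :: "'d::finite mat \<Rightarrow> bool" where
  "symm_mat A \<longleftrightarrow> transpose A = A"

definition minner :: "'d::finite mat \<Rightarrow> 'd mat \<Rightarrow> real" where
  "minner A B = trace (A ** B)"

definition grass :: "nat \<Rightarrow> 'd::finite mat set" where
  "grass k = {P. symm_mat P \<and> P ** P = P \<and> trace P = real k}"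

definition grass_measure :: "nat \<Rightarrow> 'd::finite mat measure \<Rightarrow> bool" where
  "grass_measure k \<sigma> \<longleftrightarrow> prob_space \<sigma> \<and> sets \<sigma> = sets borel \<and> emeasure \<sigma> (grass k) = 1 \<and>
     (\<forall>U. orthogonal_matrix U \<longrightarrow> distr \<sigma> borel (\<lambda>P. U ** P ** transpose U) = \<sigma>)"

definition mat_monomial :: "('d \<times> 'd \<Rightarrow> nat) \<Rightarrow> 'd::finite mat \<Rightarrow> real" where
  "mat_monomial e P = (\<Prod>ij\<in>UNIV. (P $ fst ij $ snd ij) ^ e ij)"

text \<open>Pol_t: polynomials of degree at most t on the matrix space (restricted to
  the Grassmannian only through evaluation at its points / integration against sigma).\<close>
definition Pol :: "nat \<Rightarrow> ('d::finite mat \<Rightarrow> real) set" where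
  "Pol t = {f. \<exists>c. f = (\<lambda>P. \<Sum>e\<in>{e. sum e UNIV \<le> t}. c e * mat_monomial e P)}"

definition Pol_rank :: "nat \<Rightarrow> nat \<Rightarrow> ('d::finite mat \<Rightarrow> real) set" where
  "Pol_rank l t = {f. \<exists>L :: (real \<times> 'd mat \<times> nat) list.
      (\<forall>(c, M, s)\<in>set L. symm_mat M \<and> rank M \<le> l \<and> s \<le> t) \<and>
      f = (\<lambda>P. \<Sum>(c, M, s)\<leftarrow>L. c * minner M P ^ s)}"

definition exact_cubature :: "nat \<Rightarrow> 'd::finite mat measure \<Rightarrow> ('d mat \<Rightarrow> real) set
    \<Rightarrow> ('d mat \<times> real) list \<Rightarrow> bool" where
  "exact_cubature k \<sigma> V cub \<longleftrightarrow> (\<forall>(P, w)\<in>set cub. P \<in> grass k) \<and>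
     (\<forall>f\<in>V. (\<Sum>(P, w)\<leftarrow>cub. w * f P) = integral\<^sup>L \<sigma> f)"

definition Kt :: "nat \<Rightarrow> 'd::finite mat \<Rightarrow> 'd mat \<Rightarrow> real" where
  "Kt t P Q = minner P Q ^ t"

definition Kfun :: "nat \<Rightarrow> (real \<times> 'd::finite mat) list \<Rightarrow> 'd mat \<Rightarrow> real" where
  "Kfun t L P = (\<Sum>(c, Q)\<leftarrow>L. c * Kt t Q P)"

definition Knorm_sq :: "nat \<Rightarrow> (real \<times> 'd::finite mat) list \<Rightarrow> real" where
  "Knorm_sq t L = (\<Sum>(c, Q)\<leftarrow>L. \<Sum>(c', Q')\<leftarrow>L. c * c' * Kt t Q Q')"

text \<open>epsilon-approximate cubature for Pol_t(G_{k,d}) with respect to K_t: the error is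
  at most epsilon for every f in Pol_t with K_t-norm 1, every such f being written
  as f = sum_i c_i K_t(Q_i, .) with Q_i in G_{k,d}.\<close>
definition approx_cubature :: "real \<Rightarrow> nat \<Rightarrow> nat \<Rightarrow> 'd::finite mat measure
    \<Rightarrow> ('d mat \<times> real) list \<Rightarrow> bool" where
  "approx_cubature \<epsilon> t k \<sigma> cub \<longleftrightarrow> (\<forall>(P, w)\<in>set cub. P \<in> grass k) \<and>
     (\<forall>L :: (real \<times> 'd mat) list. (\<forall>(c, Q)\<in>set L. Q \<in> grass k) \<and> Kfun t L \<in> Pol t \<and>
        Knorm_sq t L = 1 \<longrightarrow>
        \<bar>(\<Sum>(P, w)\<leftarrow>cub. w * Kfun t L P) - integral\<^sup>L \<sigma> (Kfun t L)\<bar> \<le> \<epsilon>)"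

definition vpow :: "real^'d::finite \<Rightarrow> ('d \<Rightarrow> nat) \<Rightarrow> real" where
  "vpow x \<beta> = (\<Prod>i\<in>UNIV. (x $ i) ^ \<beta> i)"

definition mi_deg :: "('d::finite \<Rightarrow> nat) \<Rightarrow> nat" where
  "mi_deg \<beta> = sum \<beta> UNIV"

end

(*
  Write words of length t for the index set of the t-fold tensor power of R^d. Since each projector P
  is a positive semidefinite idempotent, so is its tensor power, and E P^(t) (the expectation over
  sigma) is positive semidefinite with kernel orthogonal to all x^(t): a kernel vector is killed by
  almost every P, by invariance also by projectors fixing a prescribed x. Hence every homogeneous
  polynomial of degree t in x is a combination of the averages of <y, P x>^t, for every k >= 1 and
  every t. As <y, P x>^t is the t-th power of the inner product of P with a matrix of rank at most 2,
  this gives the exact identities, with coefficients supported on degree t even in part (i).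
  For the error bound, P -> <M, P>^t coincides on the Grassmannian with a combination of kernel
  functions, which represents the projection of M^(t) to the span of all Q^(t), so its K_t-norm
  is at most the t-th power of the Frobenius norm of M; for M = y x^T this is (|y| |x|)^t.
*)
theory Submission
  imports Defs
begin

section \<open>Words and monomials\<close>

text \<open>Index set of a basis of the t-fold tensor power. The extensional function space gives
  each word exactly one representative, so the set is finite.\<close>

definition words :: "nat \<Rightarrow> (nat \<Rightarrow> 'n) set" where
  "words t = {..<t} \<rightarrow>\<^sub>E UNIV"

text \<open>The coordinates of the tensor power z^(t).\<close>

definition word_monom :: "nat \<Rightarrow> ('n \<Rightarrow> real) \<Rightarrow> (nat \<Rightarrow> 'n) \<Rightarrow> real" where
  "word_monom t z w = (\<Prod>j<t. z (w j))"

definition word_count :: "nat \<Rightarrow> (nat \<Rightarrow> 'n) \<Rightarrow> 'n \<Rightarrow> nat" where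
  "word_count t w i = card {j. j < t \<and> w j = i}"

lemma finite_words [simp]: "finite (words t :: (nat \<Rightarrow> 'n::finite) set)"
  unfolding words_def by (intro finite_PiE) auto

lemma prod_sum_words:
  "(\<Prod>j<t. \<Sum>i\<in>UNIV. f j i) = (\<Sum>w\<in>words t. \<Prod>j<t. f j (w j))"
  for f :: "nat \<Rightarrow> 'n::finite \<Rightarrow> real"
  unfolding words_def by (rule prod_sum_PiE) auto

text \<open>In tensor terms <a^(t), b^(t)> = <a, b>^t, which makes t-th powers of inner products
  linear in each tensor power.\<close>

lemma sum_word_monom_mult:
  "(\<Sum>w\<in>words t. word_monom t a w * word_monom t b w) = (\<Sum>i\<in>UNIV. a i * b i) ^ t"
  for a b :: "'n::finite \<Rightarrow> real"
  using prod_sum_words[where t = t and f = "\<lambda>_ i. a i * b i"]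
  by (simp add: word_monom_def prod.distrib)

lemma word_monom_eq_count:
  "word_monom t z w = (\<Prod>i\<in>UNIV. z i ^ word_count t w i)" for z :: "'n::finite \<Rightarrow> real"
proof -
  have "word_monom t z w = (\<Prod>i\<in>UNIV. \<Prod>j | j \<in> {..<t} \<and> w j = i. z (w j))"
    unfolding word_monom_def by (rule prod.group[symmetric]) auto
  also have "\<dots> = (\<Prod>i\<in>UNIV. z i ^ word_count t w i)"
    by (rule prod.cong) (auto simp: word_count_def)
  finally show ?thesis .
qed

lemma sum_word_count: "sum (word_count t w) UNIV = t" for w :: "nat \<Rightarrow> 'n::finite"
proof -
  have "(\<Sum>i\<in>UNIV. \<Sum>j | j \<in> {..<t} \<and> w j = i. (1::nat)) = (\<Sum>j<t. 1)"
    by (rule sum.group) auto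
  then show ?thesis by (simp add: word_count_def)
qed

lemma finite_sum_le: "finite {e :: 'n::finite \<Rightarrow> nat. sum e UNIV \<le> t}"
proof (rule finite_subset)
  show "{e :: 'n \<Rightarrow> nat. sum e UNIV \<le> t} \<subseteq> UNIV \<rightarrow>\<^sub>E {..t}"
    by (auto intro: order_trans[OF member_le_sum[of _ UNIV]])
qed (intro finite_PiE, auto)

lemma finite_sum_eq: "finite {e :: 'n::finite \<Rightarrow> nat. sum e UNIV = t}"
  by (rule finite_subset[OF _ finite_sum_le[of t]]) auto

text \<open>Words that are rearrangements of each other give the same commutative monomial, so their
  coefficients add up.\<close>

lemma sum_words_collect:
  fixes b :: "(nat \<Rightarrow> 'n::finite) \<Rightarrow> real"
  shows "(\<Sum>w\<in>words t. b w * word_monom t z w) =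
    (\<Sum>e | sum e UNIV = t. (\<Sum>w | w \<in> words t \<and> word_count t w = e. b w) * (\<Prod>i\<in>UNIV. z i ^ e i))"
proof -
  have "(\<Sum>w\<in>words t. b w * word_monom t z w) =
    (\<Sum>e | sum e UNIV = t. \<Sum>w | w \<in> words t \<and> word_count t w = e. b w * word_monom t z w)"
    by (rule sum.group[symmetric]) (auto simp: finite_sum_eq sum_word_count)
  then show ?thesis
    by (auto simp: sum_distrib_right word_monom_eq_count intro!: sum.cong)
qed

text \<open>The word is built letter by letter: lower some nonzero exponent by one, take a word for
  the rest and append the letter.\<close>

lemma monomial_eq_word_monom:
  fixes e :: "'n::finite \<Rightarrow> nat"
  assumes "sum e UNIV = t"
  shows "\<exists>w\<in>words t. \<forall>z. word_monom t z w = (\<Prod>i\<in>UNIV. z i ^ e i)"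
  using assms
proof (induction t arbitrary: e)
  case 0
  then have "e i = 0" for i by simp
  then show ?case by (auto simp: words_def word_monom_def)
next
  case (Suc t)
  then obtain i where i: "e i \<noteq> 0" by (metis nat.distinct(1) sum.neutral)
  define e' where "e' = e(i := e i - 1)"
  have e: "e = e'(i := Suc (e' i))" using i by (auto simp: e'_def)
  have "sum e UNIV = Suc (sum e' UNIV)"
    by (subst (1 2) sum.remove[of UNIV i]) (auto simp: e)
  then have "sum e' UNIV = t" using Suc.prems by simp
  then obtain w where w: "w \<in> words t" "\<And>z. word_monom t z w = (\<Prod>i\<in>UNIV. z i ^ e' i)"
    using Suc.IH by blast
  have "word_monom (Suc t) z (w(t := i)) = (\<Prod>i\<in>UNIV. z i ^ e i)" for z
  proof -
    have "word_monom (Suc t) z (w(t := i)) = word_monom t z w * z i"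
      by (auto simp: word_monom_def intro!: prod.cong)
    also have "\<dots> = (\<Prod>i\<in>UNIV. z i ^ e i)"
      unfolding w(2) by (subst (1 2) prod.remove[of UNIV i]) (auto simp: e)
    finally show ?thesis .
  qed
  moreover have "w(t := i) \<in> words (Suc t)"
    using w(1) by (auto simp: words_def PiE_def extensional_def)
  ultimately show ?case by blast
qed

section \<open>Linear algebra: spaces of functions that attain all values on a finite set\<close>

text \<open>Finite-dimensional duality, by induction on \<open>B\<close>. Prescribed values on
  \<open>B\<close> can be corrected at a new point \<open>b\<close> once some member of
  \<open>S\<close> vanishes on \<open>B\<close> but not at \<open>b\<close>. Without such a member
  the value at \<open>b\<close> would be a fixed linear function of the values on \<open>B\<close>,
  which yields a nonzero annihilator.\<close>

lemma subspace_eq_UNIV_if_annihilator_zero: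
  fixes S :: "('b \<Rightarrow> real) set"
  assumes fin: "finite B"
    and lin: "\<And>a u v. u \<in> S \<Longrightarrow> v \<in> S \<Longrightarrow> (\<lambda>x. a * u x + v x) \<in> S"
    and zero: "(\<lambda>x. 0) \<in> S"
    and ann: "\<And>l. (\<And>v. v \<in> S \<Longrightarrow> (\<Sum>x\<in>B. l x * v x) = 0) \<Longrightarrow> (\<And>x. x \<in> B \<Longrightarrow> l x = 0)"
  shows "\<exists>v\<in>S. \<forall>x\<in>B. v x = e x"
  using fin ann
proof (induction B arbitrary: e)
  case empty
  then show ?case using zero by auto
next
  case (insert b B)
  have IH: "\<exists>v\<in>S. \<forall>x\<in>B. v x = e x" for e
  proof (rule insert.IH)
    fix l x assume l: "\<And>v. v \<in> S \<Longrightarrow> (\<Sum>x\<in>B. l x * v x) = 0" and x: "x \<in> B"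
    \<comment> \<open>An annihilator on \<open>B\<close>, extended by 0 at \<open>b\<close>, is an
      annihilator on \<open>insert b B\<close>.\<close>
    have "(l(b := 0)) x = 0"
    proof (rule insert.prems)
      fix v assume "v \<in> S"
      have "(\<Sum>x\<in>insert b B. (l(b := 0)) x * v x) = (\<Sum>x\<in>B. (l(b := 0)) x * v x)"
        using insert.hyps by simp
      also have "\<dots> = (\<Sum>x\<in>B. l x * v x)"
        using insert.hyps by (intro sum.cong) auto
      finally show "(\<Sum>x\<in>insert b B. (l(b := 0)) x * v x) = 0"
        using l[OF \<open>v \<in> S\<close>] by simp
    qed (use x in auto)
    then show "l x = 0" using x insert.hyps by (auto split: if_splits)
  qed
  have "\<exists>v\<in>S. (\<forall>x\<in>B. v x = 0) \<and> v b \<noteq> 0"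
  proof (rule ccontr)
    assume "\<not> ?thesis"
    then have neg: "v b = 0" if "v \<in> S" "\<forall>x\<in>B. v x = 0" for v
      using that by auto
    \<comment> \<open>On \<open>B\<close> the members \<open>u y\<close> are the unit vectors;
      subtracting all \<open>v y * u y\<close> from \<open>v\<close> makes it vanish on
      \<open>B\<close>.\<close>
    have "\<forall>y. \<exists>v\<in>S. \<forall>x\<in>B. v x = of_bool (x = y)"
      using IH[of "\<lambda>x. of_bool (x = y)" for y] by simp
    then obtain u where u: "\<And>y. u y \<in> S" "\<And>x y. x \<in> B \<Longrightarrow> u y x = of_bool (x = y)"
      by metis
    have comb: "(\<lambda>x. v x - (\<Sum>y\<in>C. v y * u y x)) \<in> S" if "v \<in> S" "finite C" for v C
      using that(2)
    proof induction
      case empty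
      then show ?case using that(1) by simp
    next
      case (insert c C)
      have "(\<lambda>x. (- v c) * u c x + (v x - (\<Sum>y\<in>C. v y * u y x))) \<in> S"
        by (rule lin[OF u(1) insert.IH])
      then show ?case using insert.hyps by (simp add: algebra_simps)
    qed
    \<comment> \<open>By \<open>neg\<close>, \<open>v b\<close> equals the sum of
      \<open>v y * u y b\<close> for each \<open>v\<close> in \<open>S\<close>, so these
      coefficients annihilate \<open>S\<close>, although the one at \<open>b\<close> is -1.\<close>
    have "(\<lambda>x. if x = b then - 1 else u x b) b = 0"
    proof (rule insert.prems[of "\<lambda>x. if x = b then - 1 else u x b" b])
      fix v assume v: "v \<in> S"
      have "v b - (\<Sum>y\<in>B. v y * u y b) = 0"
        using insert.hyps
        by (intro neg[OF comb[OF v]]) (auto simp: u(2) of_bool_def sum.delta if_distrib cong: if_cong)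
      moreover have "(\<Sum>x\<in>B. (if x = b then - 1 else u x b) * v x) = (\<Sum>y\<in>B. v y * u y b)"
        using insert.hyps by (intro sum.cong) auto
      ultimately show "(\<Sum>x\<in>insert b B. (if x = b then - 1 else u x b) * v x) = 0"
        using insert.hyps by simp
    qed simp
    then show False by simp
  qed
  then obtain v where v: "v \<in> S" "\<forall>x\<in>B. v x = 0" "v b \<noteq> 0" by blast
  obtain u where u: "u \<in> S" "\<forall>x\<in>B. u x = e x" using IH by blast
  have "(\<lambda>x. ((e b - u b) / v b) * v x + u x) \<in> S" by (rule lin[OF v(1) u(1)])
  then show ?case by (rule rev_bexI) (use u v in auto)
qed

text \<open>An annihilator of \<open>S\<close> lies in \<open>S\<close>, so it is orthogonal to
  itself and vanishes on \<open>B\<close>. This form suits spaces of coefficient vectors defined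
  through the function they represent: a vector representing zero belongs to them at once.\<close>

lemma subspace_eq_UNIV_if_contains_orthogonal:
  fixes S :: "('b \<Rightarrow> real) set"
  assumes "finite B"
    and "\<And>a u v. u \<in> S \<Longrightarrow> v \<in> S \<Longrightarrow> (\<lambda>x. a * u x + v x) \<in> S"
    and "(\<lambda>x. 0) \<in> S"
    and self: "\<And>l. (\<And>v. v \<in> S \<Longrightarrow> (\<Sum>x\<in>B. l x * v x) = 0) \<Longrightarrow> l \<in> S"
  shows "\<exists>v\<in>S. \<forall>x\<in>B. v x = e x"
proof (rule subspace_eq_UNIV_if_annihilator_zero[OF assms(1-3)])
  fix l x assume l: "\<And>v. v \<in> S \<Longrightarrow> (\<Sum>x\<in>B. l x * v x) = 0" and "x \<in> B"
  have "(\<Sum>x\<in>B. l x * l x) = 0" by (rule l) (rule self[OF l])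
  then show "l x = 0"
    using \<open>x \<in> B\<close> assms(1) by (simp add: sum_nonneg_eq_0_iff)
qed

section \<open>Projectors and their tensor powers\<close>

text \<open>The entries of the t-fold Kronecker power of \<open>P\<close>.\<close>

definition tensor_power :: "nat \<Rightarrow> real^'n^'m \<Rightarrow> (nat \<Rightarrow> 'm) \<Rightarrow> (nat \<Rightarrow> 'n) \<Rightarrow> real" where
  "tensor_power t P w w' = (\<Prod>j<t. P $ w j $ w' j)"

definition mat_entries :: "real^'n^'m \<Rightarrow> 'm \<times> 'n \<Rightarrow> real" where
  "mat_entries P ij = P $ fst ij $ snd ij"

definition outer :: "real^'m \<Rightarrow> real^'n \<Rightarrow> real^'n^'m" where
  "outer y x = (\<chi> i j. y $ i * x $ j)"

lemma word_monom_mult_vec: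
  "word_monom t (($) (P *v x)) w = (\<Sum>w'\<in>words t. tensor_power t P w w' * word_monom t (($) x) w')"
  unfolding word_monom_def tensor_power_def matrix_vector_mult_def
  by (simp add: prod_sum_words prod.distrib)

lemma tensor_power_mult:
  "tensor_power t (P ** Q) w w' = (\<Sum>v\<in>words t. tensor_power t P w v * tensor_power t Q v w')"
  unfolding tensor_power_def matrix_matrix_mult_def
  by (simp add: prod_sum_words prod.distrib)

lemma tensor_power_transpose: "tensor_power t (transpose P) w w' = tensor_power t P w' w"
  by (simp add: tensor_power_def transpose_def)

lemma inner_mat_eq_sum: "M \<bullet> P = (\<Sum>ij\<in>UNIV. mat_entries M ij * mat_entries P ij)"
  for M P :: "real^'n^'m"
  unfolding inner_vec_def mat_entries_def sum.cartesian_product UNIV_Times_UNIV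
  by (simp add: split_beta)

lemma inner_mat_power:
  "(M \<bullet> P) ^ t = (\<Sum>w\<in>words t. word_monom t (mat_entries M) w * word_monom t (mat_entries P) w)"
  for M P :: "real^'n^'m"
  by (simp add: inner_mat_eq_sum sum_word_monom_mult)

text \<open>The trace form pairs entry (i, j) of \<open>A\<close> with entry (j, i) of
  \<open>B\<close>; symmetry of \<open>A\<close> turns it into the Euclidean inner product, whose
  norm is the Frobenius norm.\<close>

lemma minner_eq_inner: "symm_mat A \<Longrightarrow> minner A B = A \<bullet> B" for A B :: "'d::finite mat"
proof -
  assume A: "symm_mat A"
  have "minner A B = minner (transpose A) B" using A by (simp add: symm_mat_def)
  also have "\<dots> = (\<Sum>i\<in>UNIV. \<Sum>j\<in>UNIV. A $ j $ i * B $ j $ i)"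
    by (simp add: minner_def trace_def matrix_matrix_mult_def transpose_def)
  also have "\<dots> = A \<bullet> B"
    by (subst sum.swap) (simp add: inner_vec_def)
  finally show ?thesis .
qed

lemma minner_commute: "minner A B = minner B A"
  unfolding minner_def by (rule trace_mul_sym)

lemma inner_outer: "outer y x \<bullet> P = y \<bullet> (P *v x)"
  by (simp add: outer_def inner_vec_def matrix_vector_mult_def sum_distrib_left ac_simps)

lemma norm_outer: "norm (outer y x) = norm y * norm x"
proof -
  have "(norm (outer y x))\<^sup>2 = (norm y)\<^sup>2 * (norm x)\<^sup>2"
    unfolding power2_norm_eq_inner inner_vec_def sum_product
    by (simp add: outer_def ac_simps)
  then show ?thesis by (simp add: power_mult_distrib[symmetric] power2_eq_iff_nonneg)
qed

section \<open>The Grassmannian and its invariant measure\<close>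

lemma grassD:
  assumes "P \<in> grass k"
  shows "symm_mat P" "transpose P = P" "P ** P = P" "trace P = real k"
  using assms by (auto simp: grass_def symm_mat_def)

lemma minner_grass_self: "P \<in> grass k \<Longrightarrow> minner P P = real k"
  by (simp add: grassD minner_def)

lemma norm_grass: "P \<in> grass k \<Longrightarrow> norm P = sqrt k"
  using minner_eq_inner[of P P] by (simp add: norm_eq_sqrt_inner minner_grass_self grassD(1))

lemma AE_grass:
  assumes "grass_measure k \<sigma>"
  shows "AE P in \<sigma>. P \<in> grass k"
proof -
  interpret prob_space \<sigma> using assms by (simp add: grass_measure_def)
  have 1: "emeasure \<sigma> (grass k) = 1" using assms by (simp add: grass_measure_def)
  \<comment> \<open>A non-measurable set has \<open>emeasure\<close> 0 by convention, so mass 1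
    forces measurability.\<close>
  then have "grass k \<in> events" by (metis emeasure_notin_sets zero_neq_one)
  then show ?thesis using 1 by (simp add: AE_in_set_eq_1 emeasure_eq_measure)
qed

lemma grass_nonempty:
  fixes \<sigma> :: "'d::finite mat measure"
  assumes "grass_measure k \<sigma>"
  shows "\<exists>P :: 'd mat. P \<in> grass k"
  using assms by (cases "(grass k :: 'd mat set) = {}") (auto simp: grass_measure_def)

text \<open>Projectors of trace k have Frobenius norm sqrt k, so a continuous function is bounded on
  a compact ball that carries \<sigma>.\<close>

lemma integrable_grass_measure:
  fixes f :: "'d::finite mat \<Rightarrow> real"
  assumes "grass_measure k \<sigma>" "continuous_on UNIV f"
  shows "integrable \<sigma> f"
proof -
  interpret prob_space \<sigma> using assms by (simp add: grass_measure_def)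
  have "compact (f ` cball 0 (sqrt k))"
    by (intro compact_continuous_image continuous_on_subset[OF assms(2)]) auto
  then obtain B where B: "\<And>P. P \<in> cball 0 (sqrt k) \<Longrightarrow> norm (f P) \<le> B"
    by (meson bounded_iff compact_imp_bounded imageI)
  show ?thesis
  proof (rule integrable_const_bound)
    show "AE P in \<sigma>. norm (f P) \<le> B"
      using AE_grass[OF assms(1)]
      by eventually_elim (rule B, simp add: norm_grass)
    have "f \<in> borel_measurable borel" by (rule borel_measurable_continuous_onI[OF assms(2)])
    then show "f \<in> borel_measurable \<sigma>"
      using assms(1) by (simp add: grass_measure_def cong: measurable_cong_sets)
  qed
qed

lemma continuous_on_tensor_power [continuous_intros]:
  "continuous_on A f \<Longrightarrow> continuous_on A (\<lambda>x. tensor_power t (f x) w w')"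
  unfolding tensor_power_def by (intro continuous_intros)

lemma continuous_on_conjugate:
  "continuous_on UNIV (\<lambda>U::real^'n^'n. U ** P ** transpose U)"
  unfolding matrix_matrix_mult_def transpose_def
  by (simp, intro continuous_intros)

lemma continuous_on_conjugate_fixed:
  "continuous_on UNIV (\<lambda>P::real^'n^'n. U ** P ** transpose U)"
  unfolding matrix_matrix_mult_def transpose_def
  by (simp, intro continuous_intros)

text \<open>A countable dense set of rotations already yields one projector all of whose rotated copies
  by that set are zeros of \<open>q\<close>; continuity extends this to every rotation.\<close>
lemma AE_grass_orbit:
  fixes q :: "'i \<Rightarrow> 'd::finite mat \<Rightarrow> real"
  assumes \<sigma>: "grass_measure k \<sigma>"
    and cont: "\<And>i. i \<in> I \<Longrightarrow> continuous_on UNIV (q i)"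
    and AE: "AE P in \<sigma>. \<forall>i\<in>I. q i P = 0"
  shows "\<exists>P\<in>grass k. \<forall>U. orthogonal_matrix U \<longrightarrow> (\<forall>i\<in>I. q i (U ** P ** transpose U) = 0)"
proof -
  interpret prob_space \<sigma> using \<sigma> by (simp add: grass_measure_def)
  have rot: "AE P in \<sigma>. \<forall>i\<in>I. q i (U ** P ** transpose U) = 0" if U: "orthogonal_matrix U" for U
  proof -
    let ?f = "\<lambda>P. U ** P ** transpose U"
    have inv: "distr \<sigma> borel ?f = \<sigma>" using \<sigma> U by (simp add: grass_measure_def)
    have "AE P in distr \<sigma> borel ?f. \<forall>i\<in>I. q i P = 0" unfolding inv by (rule AE)
    moreover have "?f \<in> measurable \<sigma> borel"
      using \<sigma> borel_measurable_continuous_onI[OF continuous_on_conjugate_fixed[of U]]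
      by (simp add: grass_measure_def cong: measurable_cong_sets)
    \<comment> \<open>The common zero set is closed whatever the size of \<open>I\<close>, hence
      Borel, as the transfer along \<open>distr\<close> requires.\<close>
    moreover have "closed (\<Inter>i\<in>I. q i -` {0})"
      by (intro closed_INT ballI closed_vimage closed_singleton cont)
    then have "{P \<in> space borel. \<forall>i\<in>I. q i P = 0} \<in> sets borel"
      by (intro borel_closed) (auto simp: vimage_def Collect_ball_eq)
    ultimately show ?thesis by (subst (asm) AE_distr_iff) auto
  qed
  obtain D where D: "countable D" "D \<subseteq> {U :: 'd mat. orthogonal_matrix U}"
      "{U :: 'd mat. orthogonal_matrix U} \<subseteq> closure D"
    using separable[of "{U :: 'd mat. orthogonal_matrix U}"] by metis
  have "AE P in \<sigma>. \<forall>U\<in>D. \<forall>i\<in>I. q i (U ** P ** transpose U) = 0"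
    by (rule AE_ball_countable') (use D rot in auto)
  then have "AE P in \<sigma>. P \<in> grass k \<and> (\<forall>U\<in>D. \<forall>i\<in>I. q i (U ** P ** transpose U) = 0)"
    using AE_grass[OF \<sigma>] by eventually_elim auto
  then have "\<exists>P. P \<in> grass k \<and> (\<forall>U\<in>D. \<forall>i\<in>I. q i (U ** P ** transpose U) = 0)"
    using eventually_happens[of _ "ae_filter \<sigma>"] ae_filter_bot by auto
  then obtain P where P: "P \<in> grass k" "\<And>U i. U \<in> D \<Longrightarrow> i \<in> I \<Longrightarrow> q i (U ** P ** transpose U) = 0"
    by blast
  have "q i (U ** P ** transpose U) = 0" if U: "orthogonal_matrix U" and i: "i \<in> I" for U i
  proof -
    have "continuous_on UNIV (\<lambda>U. q i (U ** P ** transpose U))"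
      by (rule continuous_on_compose2[OF cont[OF i] continuous_on_conjugate]) auto
    then have "closed ((\<lambda>U. q i (U ** P ** transpose U)) -` {0})"
      by (intro closed_vimage closed_singleton)
    then have "closure D \<subseteq> (\<lambda>U. q i (U ** P ** transpose U)) -` {0}"
      by (intro closure_minimal) (use P(2) i in auto)
    then show ?thesis using D(3) U by auto
  qed
  then show ?thesis using P(1) by blast
qed

text \<open>A nonzero projector fixes vectors of every length; conjugation by an orthogonal matrix
  carrying one of them to \<open>x\<close> gives a projector that fixes \<open>x\<close>.\<close>

lemma grass_orbit_fixes:
  fixes P :: "'d::finite mat"
  assumes "P \<in> grass k" "1 \<le> k"
  shows "\<exists>U. orthogonal_matrix U \<and> (U ** P ** transpose U) *v x = x"
proof -
  have "P \<noteq> 0" using assms by (auto dest: norm_grass)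
  then obtain v where v: "P *v v \<noteq> 0" by (metis matrix_eq matrix_vector_mult_0)
  \<comment> \<open>Scaled to the length of \<open>x\<close>, since orthogonal maps preserve norms;
    for x = 0 it is 0.\<close>
  define u where "u = (norm x / norm (P *v v)) *\<^sub>R (P *v v)"
  have "P *v (P *v v) = P *v v"
    using grassD(3)[OF assms(1)] by (simp add: matrix_vector_mul_assoc)
  then have Pu: "P *v u = u" by (simp add: u_def matrix_vector_mult_scaleR)
  have "norm u = norm x" using v by (simp add: u_def)
  then obtain f where f: "orthogonal_transformation f" "f u = x"
    using orthogonal_transformation_exists by blast
  define U where "U = matrix f"
  have U: "orthogonal_matrix U" "U *v u = x"
    using f by (auto simp: U_def orthogonal_transformation_matrix)
  then have "transpose U *v x = u"
    by (metis matrix_vector_mul_assoc matrix_vector_mul_lid orthogonal_matrix_def)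
  then show ?thesis
    using U Pu by (metis matrix_vector_mul_assoc)
qed

section \<open>Weighted sums over lists, and powers of the form <y, P x>\<close>

lemma sum_list_pair_scale:
  "(\<Sum>(c, y)\<leftarrow>map (\<lambda>(c, y). (a * c, y)) L. c * F y) = a * (\<Sum>(c, y)\<leftarrow>L. c * F y)"
  for a :: real
  by (induction L) (auto simp: algebra_simps)

lemma sum_list_pair_sum:
  "(\<Sum>(c, y)\<leftarrow>L. c * (\<Sum>w\<in>W. g w * f y w)) = (\<Sum>w\<in>W. g w * (\<Sum>(c, y)\<leftarrow>L. c * f y w))"
  for g :: "'w \<Rightarrow> real"
proof (induction L)
  case (Cons p L)
  then show ?case by (cases p) (simp add: sum_distrib_left sum.distrib algebra_simps)
qed simp

text \<open>This is <y, P x>^t = <y^(t), P^(t) x^(t)>. The entries of P^(t) occur linearly, so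
  averaging over P acts entry by entry.\<close>

lemma inner_mult_vec_power:
  "(y \<bullet> (P *v x)) ^ t =
    (\<Sum>w\<in>words t. \<Sum>w'\<in>words t. word_monom t (($) y) w * word_monom t (($) x) w' * tensor_power t P w w')"
  for P :: "real^'n^'m"
proof -
  have "(y \<bullet> (P *v x)) ^ t = (\<Sum>w\<in>words t. word_monom t (($) y) w * word_monom t (($) (P *v x)) w)"
    by (simp add: inner_vec_def sum_word_monom_mult)
  then show ?thesis by (simp add: word_monom_mult_vec sum_distrib_left ac_simps)
qed

section \<open>The averaged tensor power\<close>

definition mean_tensor :: "nat \<Rightarrow> 'd::finite mat measure \<Rightarrow> (nat \<Rightarrow> 'd) \<Rightarrow> (nat \<Rightarrow> 'd) \<Rightarrow> real" where
  "mean_tensor t \<sigma> w w' = (\<integral>P. tensor_power t P w w' \<partial>\<sigma>)"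

lemma integrable_tensor_power:
  "grass_measure k \<sigma> \<Longrightarrow> integrable \<sigma> (\<lambda>P. tensor_power t P w w')"
  by (rule integrable_grass_measure) (auto intro: continuous_intros)

lemma integral_inner_power:
  assumes "grass_measure k \<sigma>"
  shows "(\<integral>P. (y \<bullet> (P *v x)) ^ t \<partial>\<sigma>) =
    (\<Sum>w\<in>words t. \<Sum>w'\<in>words t. word_monom t (($) y) w * word_monom t (($) x) w' * mean_tensor t \<sigma> w w')"
  unfolding inner_mult_vec_power mean_tensor_def
  by (simp add: integrable_tensor_power[OF assms])

text \<open>The averaged projector \<open>mean_tensor\<close> is a positive semidefinite form, as \<open>tensor_power t P\<close> is an
  orthogonal projector for every \<open>P\<close>. A vector in its kernel is killed by almost all, hence by
  suitable rotated projectors fixing any prescribed \<open>x\<close>, so its polynomial vanishes at \<open>x\<close>.\<close>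
lemma mean_tensor_kernel:
  fixes \<sigma> :: "'d::finite mat measure"
  assumes \<sigma>: "grass_measure k \<sigma>" and "1 \<le> k"
    and ker: "(\<Sum>w\<in>words t. \<Sum>w'\<in>words t. l w * l w' * mean_tensor t \<sigma> w w') = 0"
  shows "(\<Sum>w\<in>words t. l w * word_monom t (($) x) w) = 0"
proof -
  define q where "q v P = (\<Sum>w\<in>words t. tensor_power t P v w * l w)" for v and P :: "'d mat"
  have cont: "continuous_on UNIV (q v)" for v
    unfolding q_def by (intro continuous_intros)
  \<comment> \<open>The left side is |P^(t) l|^2, and P^(t) is symmetric and idempotent.\<close>
  have sq: "(\<Sum>v\<in>words t. (q v P)\<^sup>2) = (\<Sum>w\<in>words t. \<Sum>w'\<in>words t. l w * l w' * tensor_power t P w w')"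
    if P: "P \<in> grass k" for P
  proof -
    have "(\<Sum>v\<in>words t. (q v P)\<^sup>2) =
      (\<Sum>v\<in>words t. \<Sum>w\<in>words t. \<Sum>w'\<in>words t. l w * l w' * (tensor_power t P w v * tensor_power t P v w'))"
      using grassD(2)[OF P] tensor_power_transpose[of t P]
      by (simp add: q_def power2_eq_square sum_product ac_simps)
    also have "\<dots> = (\<Sum>w\<in>words t. \<Sum>v\<in>words t. \<Sum>w'\<in>words t. l w * l w' * (tensor_power t P w v * tensor_power t P v w'))"
      by (rule sum.swap)
    also have "\<dots> = (\<Sum>w\<in>words t. \<Sum>w'\<in>words t. \<Sum>v\<in>words t. l w * l w' * (tensor_power t P w v * tensor_power t P v w'))"
      by (intro sum.cong refl sum.swap)
    also have "\<dots> = (\<Sum>w\<in>words t. \<Sum>w'\<in>words t. l w * l w' * tensor_power t (P ** P) w w')"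
      by (simp add: tensor_power_mult sum_distrib_left)
    finally show ?thesis using grassD(3)[OF P] by simp
  qed
  have int: "integrable \<sigma> (\<lambda>P. \<Sum>v\<in>words t. (q v P)\<^sup>2)"
    by (rule integrable_grass_measure[OF \<sigma>]) (intro continuous_intros cont)
  have "(\<integral>P. (\<Sum>v\<in>words t. (q v P)\<^sup>2) \<partial>\<sigma>) =
      (\<integral>P. (\<Sum>w\<in>words t. \<Sum>w'\<in>words t. l w * l w' * tensor_power t P w w') \<partial>\<sigma>)"
  proof (rule integral_cong_AE)
    show "AE P in \<sigma>. (\<Sum>v\<in>words t. (q v P)\<^sup>2) = (\<Sum>w\<in>words t. \<Sum>w'\<in>words t. l w * l w' * tensor_power t P w w')"
      using AE_grass[OF \<sigma>] by eventually_elim (rule sq)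
    show "(\<lambda>P. \<Sum>w\<in>words t. \<Sum>w'\<in>words t. l w * l w' * tensor_power t P w w') \<in> borel_measurable \<sigma>"
      by (intro borel_measurable_integrable integrable_grass_measure[OF \<sigma>] continuous_intros)
  qed (rule borel_measurable_integrable[OF int])
  also have "\<dots> = 0"
    using ker by (simp add: integrable_tensor_power[OF \<sigma>] mean_tensor_def)
  finally have "AE P in \<sigma>. (\<Sum>v\<in>words t. (q v P)\<^sup>2) = 0"
    by (subst (asm) integral_nonneg_eq_0_iff_AE[OF int]) (auto simp: sum_nonneg)
  then have "AE P in \<sigma>. \<forall>v\<in>words t. q v P = 0"
    by eventually_elim (simp add: sum_nonneg_eq_0_iff)
  then obtain P where P: "P \<in> grass k"
      "\<And>U v. orthogonal_matrix U \<Longrightarrow> v \<in> words t \<Longrightarrow> q v (U ** P ** transpose U) = 0"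
    using AE_grass_orbit[where I = "words t" and q = q, OF \<sigma> cont] by auto
  obtain U where U: "orthogonal_matrix U" "(U ** P ** transpose U) *v x = x"
    using grass_orbit_fixes[OF P(1) \<open>1 \<le> k\<close>] by blast
  define R where "R = U ** P ** transpose U"
  have R: "transpose R = R"
    using grassD(2)[OF P(1)] by (simp add: R_def matrix_transpose_mul matrix_mul_assoc)
  \<comment> \<open>\<open>R\<close> is symmetric and fixes \<open>x\<close>, so <l, x^(t)> = <l,
    R^(t) x^(t)> = <R^(t) l, x^(t)>, and R^(t) l = 0 by the choice of \<open>P\<close>.\<close>
  have "(\<Sum>w\<in>words t. l w * word_monom t (($) x) w) = (\<Sum>w\<in>words t. l w * word_monom t (($) (R *v x)) w)"
    using U(2) by (simp add: R_def)
  also have "\<dots> = (\<Sum>w\<in>words t. \<Sum>v\<in>words t. word_monom t (($) x) v * (tensor_power t R v w * l w))"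
    using tensor_power_transpose[of t R] by (simp add: word_monom_mult_vec sum_distrib_left R ac_simps)
  also have "\<dots> = (\<Sum>v\<in>words t. word_monom t (($) x) v * q v R)"
    by (subst sum.swap) (simp add: q_def sum_distrib_left)
  also have "\<dots> = 0" using P(2)[OF U(1)] by (simp add: R_def)
  finally show ?thesis .
qed

text \<open>Let T be the averaged tensor power and \<open>S\<close> the set of coefficient vectors
  whose polynomials have such a representation; it contains every T y^(t). If l is orthogonal to
  \<open>S\<close>, then T l is orthogonal to all y^(t), so it represents the zero polynomial and
  lies in \<open>S\<close>. Hence <l, T l> = 0, and \<open>mean_tensor_kernel\<close> puts l itself
  into \<open>S\<close>.\<close>

lemma polynomial_eq_averaged_powers:
  fixes \<sigma> :: "'d::finite mat measure"
  assumes \<sigma>: "grass_measure k \<sigma>" and "1 \<le> k"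
  shows "\<exists>L :: (real \<times> (real^'d)) list. \<forall>x.
    (\<Sum>w\<in>words t. e w * word_monom t (($) x) w) = (\<Sum>(c, y)\<leftarrow>L. c * (\<integral>P. (y \<bullet> (P *v x)) ^ t \<partial>\<sigma>))"
proof -
  define S where "S = {v. \<exists>L :: (real \<times> (real^'d)) list. \<forall>x.
    (\<Sum>w\<in>words t. v w * word_monom t (($) x) w) = (\<Sum>(c, y)\<leftarrow>L. c * (\<integral>P. (y \<bullet> (P *v x)) ^ t \<partial>\<sigma>))}"
  have zeroI: "v \<in> S" if "\<And>x. (\<Sum>w\<in>words t. v w * word_monom t (($) x) w) = 0" for v
    unfolding S_def using that by (auto intro!: exI[of _ "[]"])
  have "\<exists>v\<in>S. \<forall>w\<in>words t. v w = e w"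
  proof (rule subspace_eq_UNIV_if_contains_orthogonal)
    fix a u v assume "u \<in> S" "v \<in> S"
    then obtain Lu Lv :: "(real \<times> (real^'d)) list" where
      "\<And>x. (\<Sum>w\<in>words t. u w * word_monom t (($) x) w) = (\<Sum>(c, y)\<leftarrow>Lu. c * (\<integral>P. (y \<bullet> (P *v x)) ^ t \<partial>\<sigma>))"
      "\<And>x. (\<Sum>w\<in>words t. v w * word_monom t (($) x) w) = (\<Sum>(c, y)\<leftarrow>Lv. c * (\<integral>P. (y \<bullet> (P *v x)) ^ t \<partial>\<sigma>))"
      unfolding S_def by blast
    then have "(\<Sum>w\<in>words t. (a * u w + v w) * word_monom t (($) x) w) =
        (\<Sum>(c, y)\<leftarrow>map (\<lambda>(c, y). (a * c, y)) Lu @ Lv. c * (\<integral>P. (y \<bullet> (P *v x)) ^ t \<partial>\<sigma>))" for x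
      unfolding map_append sum_list_append sum_list_pair_scale
      by (simp add: distrib_right sum.distrib mult.assoc flip: sum_distrib_left)
    then show "(\<lambda>w. a * u w + v w) \<in> S" unfolding S_def by blast
  next
    fix l assume l: "\<And>v. v \<in> S \<Longrightarrow> (\<Sum>w\<in>words t. l w * v w) = 0"
    have ave: "(\<lambda>w'. \<Sum>w\<in>words t. word_monom t (($) y) w * mean_tensor t \<sigma> w w') \<in> S" for y
    proof -
      have "(\<Sum>w'\<in>words t. (\<Sum>w\<in>words t. word_monom t (($) y) w * mean_tensor t \<sigma> w w') * word_monom t (($) x) w') =
          (\<integral>P. (y \<bullet> (P *v x)) ^ t \<partial>\<sigma>)" for x
        unfolding integral_inner_power[OF \<sigma>]
        by (subst sum.swap) (simp add: sum_distrib_left ac_simps)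
      then show ?thesis unfolding S_def by (auto intro!: exI[of _ "[(1, y)]"])
    qed
    have "(\<lambda>w. \<Sum>w'\<in>words t. mean_tensor t \<sigma> w w' * l w') \<in> S"
    proof (rule zeroI)
      fix x :: "real^'d"
      have "(\<Sum>w\<in>words t. (\<Sum>w'\<in>words t. mean_tensor t \<sigma> w w' * l w') * word_monom t (($) x) w) =
          (\<Sum>w'\<in>words t. l w' * (\<Sum>w\<in>words t. word_monom t (($) x) w * mean_tensor t \<sigma> w w'))"
        unfolding sum_distrib_left sum_distrib_right
        by (subst sum.swap) (simp add: ac_simps)
      then show "(\<Sum>w\<in>words t. (\<Sum>w'\<in>words t. mean_tensor t \<sigma> w w' * l w') * word_monom t (($) x) w) = 0"
        using l[OF ave] by simp
    qed
    from l[OF this]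
    have "(\<Sum>w\<in>words t. \<Sum>w'\<in>words t. l w * l w' * mean_tensor t \<sigma> w w') = 0"
      by (simp add: sum_distrib_left ac_simps)
    then show "l \<in> S"
      by (intro zeroI mean_tensor_kernel[OF assms])
  qed (auto intro: zeroI)
  then show ?thesis unfolding S_def by fastforce
qed

section \<open>The kernel norm and approximate cubatures\<close>

text \<open>The kernel as an inner product of tensor powers; the transpose reflects the order of
  indices in the trace.\<close>

lemma Kt_eq: "Kt t Q P = (\<Sum>w\<in>words t. word_monom t (mat_entries P) w * word_monom t (mat_entries (transpose Q)) w)"
proof -
  have "Kt t Q P = (transpose Q \<bullet> P) ^ t"
    by (simp add: Kt_def minner_def trace_def matrix_matrix_mult_def inner_vec_def transpose_def)
      (subst sum.swap, simp)
  then show ?thesis by (simp add: inner_mat_power ac_simps)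
qed

lemma Kt_commute: "Kt t P Q = Kt t Q P"
  by (simp add: Kt_def minner_commute[of P])

lemma Kt_grass: "Q \<in> grass k \<Longrightarrow> Kt t Q P = (Q \<bullet> P) ^ t"
  by (simp add: Kt_def minner_eq_inner grassD(1))

text \<open>The tensor representing \<open>Kfun t L\<close>: evaluation at P is its pairing with
  P^(t).\<close>

definition kernel_feature :: "nat \<Rightarrow> (real \<times> 'd::finite mat) list \<Rightarrow> (nat \<Rightarrow> 'd \<times> 'd) \<Rightarrow> real" where
  "kernel_feature t L w = (\<Sum>(c, Q)\<leftarrow>L. c * word_monom t (mat_entries (transpose Q)) w)"

lemma Kfun_eq: "Kfun t L P = (\<Sum>w\<in>words t. word_monom t (mat_entries P) w * kernel_feature t L w)"
  unfolding Kfun_def Kt_eq kernel_feature_def sum_list_pair_sum ..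

text \<open>Reproducing property of the kernel.\<close>

lemma Knorm_sq_eq_Kfun: "Knorm_sq t L = (\<Sum>(c, Q)\<leftarrow>L. c * Kfun t L Q)"
proof -
  have "(\<Sum>(c', Q')\<leftarrow>K. c * c' * Kt t Q Q') = c * Kfun t K Q" for c Q and K :: "(real \<times> 'a mat) list"
    unfolding Kfun_def by (induction K) (auto simp: algebra_simps Kt_commute[of t Q])
  then show ?thesis by (simp add: Knorm_sq_def split_beta)
qed

text \<open>On symmetric matrices K_t is the inner product of tensor powers, so the kernel norm is
  the Euclidean norm of the feature tensor.\<close>

lemma Knorm_sq_eq:
  assumes "\<forall>(c, Q)\<in>set L. Q \<in> grass k"
  shows "Knorm_sq t L = (\<Sum>w\<in>words t. (kernel_feature t L w)\<^sup>2)"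
proof -
  have "Knorm_sq t L = (\<Sum>(c, Q)\<leftarrow>L. c * (\<Sum>w\<in>words t. kernel_feature t L w * word_monom t (mat_entries (transpose Q)) w))"
    unfolding Knorm_sq_eq_Kfun
    using assms by (intro arg_cong[of _ _ sum_list] map_cong) (auto simp: Kfun_eq grassD(2) ac_simps)
  also have "\<dots> = (\<Sum>w\<in>words t. kernel_feature t L w * kernel_feature t L w)"
    unfolding sum_list_pair_sum by (simp add: kernel_feature_def)
  finally show ?thesis by (simp add: power2_eq_square)
qed

lemma continuous_on_inner_power: "continuous_on UNIV (\<lambda>P. (M \<bullet> P) ^ t)" for M :: "'a::real_inner"
  by (intro continuous_intros)

lemma continuous_on_Kfun: "continuous_on UNIV (Kfun t L)"
  unfolding Kfun_eq[abs_def] word_monom_def mat_entries_def by (intro continuous_intros)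

text \<open>Kernel functions are homogeneous of degree t in the entries, so coefficients of lower
  degree are 0. This supplies the clause \<open>Kfun t L \<in> Pol t\<close> of
  \<open>approx_cubature\<close>.\<close>

lemma Kfun_in_Pol: "Kfun t L \<in> Pol t"
proof -
  define c where "c e = (if sum e UNIV = t then \<Sum>w | w \<in> words t \<and> word_count t w = e. kernel_feature t L w else 0)" for e
  have "Kfun t L P = (\<Sum>e\<in>{e. sum e UNIV \<le> t}. c e * mat_monomial e P)" for P
  proof -
    have "Kfun t L P = (\<Sum>e | sum e UNIV = t. (\<Sum>w | w \<in> words t \<and> word_count t w = e. kernel_feature t L w) *
        (\<Prod>i\<in>UNIV. mat_entries P i ^ e i))"
      unfolding sum_words_collect[symmetric] Kfun_eq by (simp add: ac_simps)
    also have "\<dots> = (\<Sum>e | sum e UNIV = t. c e * mat_monomial e P)"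
      by (intro sum.cong) (auto simp: c_def mat_monomial_def mat_entries_def)
    also have "\<dots> = (\<Sum>e\<in>{e. sum e UNIV \<le> t}. c e * mat_monomial e P)"
      by (intro sum.mono_neutral_left finite_sum_le) (auto simp: c_def)
    finally show ?thesis .
  qed
  then show ?thesis unfolding Pol_def by blast
qed

text \<open>The representable tensors include all Q^(t). A tensor orthogonal to these vanishes as a
  function on the Grassmannian and is represented by the empty list. As \<open>M\<close> is
  arbitrary, the matrices \<open>outer y x\<close> are covered.\<close>

lemma inner_power_eq_Kfun:
  fixes M :: "'d::finite mat"
  shows "\<exists>L. (\<forall>(c, Q)\<in>set L. Q \<in> grass k) \<and> (\<forall>P\<in>grass k. (M \<bullet> P) ^ t = Kfun t L P)"
proof -
  define S where "S = {v. \<exists>L :: (real \<times> 'd mat) list. (\<forall>(c, Q)\<in>set L. Q \<in> grass k) \<and>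
    (\<forall>P\<in>grass k. (\<Sum>w\<in>words t. v w * word_monom t (mat_entries P) w) = Kfun t L P)}"
  have zeroI: "v \<in> S" if "\<And>P. P \<in> grass k \<Longrightarrow> (\<Sum>w\<in>words t. v w * word_monom t (mat_entries P) w) = 0" for v
    unfolding S_def using that by (auto intro!: exI[of _ "[]"] simp: Kfun_def)
  have "\<exists>v\<in>S. \<forall>w\<in>words t. v w = word_monom t (mat_entries M) w"
  proof (rule subspace_eq_UNIV_if_contains_orthogonal)
    fix a u v assume "u \<in> S" "v \<in> S"
    then obtain Lu Lv where L:
      "\<forall>(c, Q)\<in>set Lu. Q \<in> grass k" "\<forall>(c, Q)\<in>set Lv. Q \<in> grass k"
      "\<And>P. P \<in> grass k \<Longrightarrow> (\<Sum>w\<in>words t. u w * word_monom t (mat_entries P) w) = Kfun t Lu P"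
      "\<And>P. P \<in> grass k \<Longrightarrow> (\<Sum>w\<in>words t. v w * word_monom t (mat_entries P) w) = Kfun t Lv P"
      unfolding S_def by blast
    have "(\<Sum>w\<in>words t. (a * u w + v w) * word_monom t (mat_entries P) w) =
        Kfun t (map (\<lambda>(c, y). (a * c, y)) Lu @ Lv) P" if "P \<in> grass k" for P
      unfolding Kfun_def map_append sum_list_append sum_list_pair_scale
      using L(3,4)[OF that]
      by (simp add: Kfun_def distrib_right sum.distrib mult.assoc flip: sum_distrib_left)
    then show "(\<lambda>w. a * u w + v w) \<in> S" unfolding S_def using L(1,2)
      by (auto intro!: exI[of _ "map (\<lambda>(c, y). (a * c, y)) Lu @ Lv"])
  next
    fix l assume l: "\<And>v. v \<in> S \<Longrightarrow> (\<Sum>w\<in>words t. l w * v w) = 0"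
    show "l \<in> S"
    proof (rule zeroI)
      fix Q :: "'d mat" assume Q: "Q \<in> grass k"
      have "(\<Sum>w\<in>words t. word_monom t (mat_entries Q) w * word_monom t (mat_entries P) w) = Kfun t [(1, Q)] P" for P
        using Q by (simp add: Kfun_def Kt_grass inner_mat_power)
      then have "word_monom t (mat_entries Q) \<in> S"
        unfolding S_def using Q by (auto intro!: exI[of _ "[(1, Q)]"])
      then show "(\<Sum>w\<in>words t. l w * word_monom t (mat_entries Q) w) = 0" by (rule l)
    qed
  qed (auto intro: zeroI)
  then show ?thesis unfolding S_def inner_mat_power by fastforce
qed

text \<open>The function \<open>Kfun t L\<close> represents the orthogonal projection of a tensor power of \<open>M\<close> onto the
  span of the tensor powers of projectors.\<close>
lemma Knorm_sq_le:
  fixes M :: "'d::finite mat"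
  assumes L: "\<forall>(c, Q)\<in>set L. Q \<in> grass k" and rep: "\<forall>P\<in>grass k. (M \<bullet> P) ^ t = Kfun t L P"
  shows "sqrt (Knorm_sq t L) \<le> norm M ^ t"
proof -
  let ?f = "kernel_feature t L" and ?m = "word_monom t (mat_entries M)"
  have N: "Knorm_sq t L = (\<Sum>w\<in>words t. (?f w)\<^sup>2)" by (rule Knorm_sq_eq[OF L])
  \<comment> \<open>For the feature tensor F, the reproducing property and \<open>rep\<close> give
    |F|^2 = <M^(t), F>; Cauchy-Schwarz then bounds |F|^4 by |M^(t)|^2 |F|^2.\<close>
  have "Knorm_sq t L = (\<Sum>(c, Q)\<leftarrow>L. c * (\<Sum>w\<in>words t. ?m w * word_monom t (mat_entries (transpose Q)) w))"
    unfolding Knorm_sq_eq_Kfun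
    using L rep by (intro arg_cong[of _ _ sum_list] map_cong) (auto simp: inner_mat_power grassD(2))
  also have "\<dots> = (\<Sum>w\<in>words t. ?m w * ?f w)"
    unfolding sum_list_pair_sum by (simp add: kernel_feature_def)
  finally have "(Knorm_sq t L)\<^sup>2 \<le> (\<Sum>w\<in>words t. (?m w)\<^sup>2) * Knorm_sq t L"
    using Cauchy_Schwarz_ineq_sum[of ?m ?f "words t"] by (simp add: N)
  also have "(\<Sum>w\<in>words t. (?m w)\<^sup>2) = (norm M ^ t)\<^sup>2"
    using inner_mat_power[of M M t]
    by (simp add: power2_eq_square flip: power_mult_distrib) (simp add: dot_square_norm power2_eq_square)
  finally have le: "Knorm_sq t L * Knorm_sq t L \<le> (norm M ^ t)\<^sup>2 * Knorm_sq t L"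
    by (simp add: power2_eq_square)
  have "Knorm_sq t L \<ge> 0" by (simp add: N sum_nonneg)
  then have "Knorm_sq t L \<le> (norm M ^ t)\<^sup>2"
    using le by (cases "Knorm_sq t L = 0") (auto simp: mult_le_cancel_right)
  then show ?thesis by (simp add: real_le_lsqrt)
qed

lemma sum_list_weighted_scale:
  fixes F :: "'p \<Rightarrow> real"
  shows "(\<Sum>(P, w)\<leftarrow>cub. w * (a * F P)) = a * (\<Sum>(P, w)\<leftarrow>cub. w * F P)"
  by (induction cub) (auto simp: algebra_simps)

text \<open>\<open>approx_cubature\<close> does not fix the sign of \<epsilon>, but some kernel
  function has norm 1, so \<epsilon> bounds an absolute value.\<close>

lemma approx_cubature_nonneg:
  fixes \<sigma> :: "'d::finite mat measure"
  assumes \<sigma>: "grass_measure k \<sigma>" and "1 \<le> k" and cub: "approx_cubature \<epsilon> t k \<sigma> cub"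
  shows "0 \<le> \<epsilon>"
proof -
  obtain Q :: "'d mat" where Q: "Q \<in> grass k" using grass_nonempty[OF \<sigma>] by blast
  \<comment> \<open>K_t(Q, Q) = k^t, so this factor normalises the kernel function at
    \<open>Q\<close>.\<close>
  define c where "c = 1 / sqrt (real k ^ t)"
  have "c * c * real k ^ t = 1" using \<open>1 \<le> k\<close> by (simp add: c_def)
  then have "Knorm_sq t [(c, Q)] = 1"
    by (simp add: Knorm_sq_def Kt_def minner_grass_self[OF Q])
  then have "\<bar>(\<Sum>(P, w)\<leftarrow>cub. w * Kfun t [(c, Q)] P) - integral\<^sup>L \<sigma> (Kfun t [(c, Q)])\<bar> \<le> \<epsilon>"
    using cub Q unfolding approx_cubature_def by (simp add: Kfun_in_Pol)
  then show ?thesis by linarith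
qed

text \<open>The kernel representation of <M, P>^t is scaled to norm 1; undoing the scaling
  multiplies \<epsilon> by a norm of at most |M|^t.\<close>

lemma approx_cubature_inner_power:
  fixes \<sigma> :: "'d::finite mat measure"
  assumes \<sigma>: "grass_measure k \<sigma>" and "1 \<le> k" and cub: "approx_cubature \<epsilon> t k \<sigma> cub"
  shows "\<bar>(\<Sum>(P, w)\<leftarrow>cub. w * (M \<bullet> P) ^ t) - (\<integral>P. (M \<bullet> P) ^ t \<partial>\<sigma>)\<bar> \<le> \<epsilon> * norm M ^ t"
proof -
  have eps: "0 \<le> \<epsilon>" by (rule approx_cubature_nonneg[OF assms])
  obtain L where L: "\<forall>(c, Q)\<in>set L. Q \<in> grass k" "\<forall>P\<in>grass k. (M \<bullet> P) ^ t = Kfun t L P"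
    using inner_power_eq_Kfun by blast
  define N where "N = sqrt (Knorm_sq t L)"
  have N: "0 \<le> N" "N \<le> norm M ^ t" "N\<^sup>2 = (\<Sum>w\<in>words t. (kernel_feature t L w)\<^sup>2)"
    using Knorm_sq_le[OF L] by (auto simp: N_def Knorm_sq_eq[OF L(1)] sum_nonneg)
  have sum: "(\<Sum>(P, w)\<leftarrow>cub. w * (M \<bullet> P) ^ t) = (\<Sum>(P, w)\<leftarrow>cub. w * Kfun t L P)"
    using cub L(2) unfolding approx_cubature_def by (intro arg_cong[of _ _ sum_list] map_cong) auto
  have int: "(\<integral>P. (M \<bullet> P) ^ t \<partial>\<sigma>) = integral\<^sup>L \<sigma> (Kfun t L)"
  proof (rule integral_cong_AE)
    show "AE P in \<sigma>. (M \<bullet> P) ^ t = Kfun t L P"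
      using AE_grass[OF \<sigma>] by eventually_elim (use L(2) in auto)
  qed (intro borel_measurable_integrable integrable_grass_measure[OF \<sigma>] continuous_on_Kfun continuous_on_inner_power)+
  have "\<bar>(\<Sum>(P, w)\<leftarrow>cub. w * Kfun t L P) - integral\<^sup>L \<sigma> (Kfun t L)\<bar> \<le> N * \<epsilon>"
  proof (cases "N = 0")
    case True
    \<comment> \<open>Norm 0 cannot be rescaled, but then the feature tensor is zero and the
      function vanishes identically.\<close>
    then have "kernel_feature t L w = 0" if "w \<in> words t" for w
      using N(3) that by (simp add: sum_nonneg_eq_0_iff)
    then have K: "Kfun t L = (\<lambda>P. 0)" by (simp add: Kfun_eq fun_eq_iff)
    have "(\<Sum>(P, w)\<leftarrow>cub. w * Kfun t L P) = 0" by (induction cub) (auto simp: K)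
    then show ?thesis using True by (simp add: K)
  next
    case False
    define L' where "L' = map (\<lambda>(c, Q). (1 / N * c, Q)) L"
    have L': "\<forall>(c, Q)\<in>set L'. Q \<in> grass k" using L(1) by (auto simp: L'_def)
    have "kernel_feature t L' w = 1 / N * kernel_feature t L w" for w
      unfolding kernel_feature_def L'_def by (rule sum_list_pair_scale)
    then have "Knorm_sq t L' = (1 / N)\<^sup>2 * N\<^sup>2"
      unfolding Knorm_sq_eq[OF L'] N(3) by (simp only: power_mult_distrib sum_distrib_left)
    then have "Knorm_sq t L' = 1" using False by (simp add: power_divide)
    then have le: "\<bar>(\<Sum>(P, w)\<leftarrow>cub. w * Kfun t L' P) - integral\<^sup>L \<sigma> (Kfun t L')\<bar> \<le> \<epsilon>"
      using cub L' unfolding approx_cubature_def by (simp add: Kfun_in_Pol)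
    have K: "Kfun t L' = (\<lambda>P. 1 / N * Kfun t L P)"
      unfolding Kfun_def L'_def by (rule ext) (rule sum_list_pair_scale)
    have "(\<Sum>(P, w)\<leftarrow>cub. w * Kfun t L' P) - integral\<^sup>L \<sigma> (Kfun t L') =
        ((\<Sum>(P, w)\<leftarrow>cub. w * Kfun t L P) - integral\<^sup>L \<sigma> (Kfun t L)) / N"
      unfolding K sum_list_weighted_scale by (simp add: diff_divide_distrib)
    then show ?thesis using le N(1) False by (simp add: divide_le_eq mult.commute)
  qed
  also have "\<dots> \<le> \<epsilon> * norm M ^ t"
    using mult_right_mono[OF N(2) eps] by (simp add: mult.commute)
  finally show ?thesis unfolding sum int .
qed

section \<open>Moments\<close>

lemma outer_mult_vec: "outer y x *v v = (x \<bullet> v) *\<^sub>R y"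
  by (simp add: outer_def vec_eq_iff matrix_vector_mult_def inner_vec_def sum_distrib_left ac_simps)

lemma exact_cubature_inner_power:
  fixes \<sigma> :: "'d::finite mat measure"
  assumes \<sigma>: "grass_measure k \<sigma>" and cub: "exact_cubature k \<sigma> (Pol_rank l t) cub" and "2 \<le> l"
  shows "(\<Sum>(P, w)\<leftarrow>cub. w * (y \<bullet> (P *v x)) ^ t) = (\<integral>P. (y \<bullet> (P *v x)) ^ t \<partial>\<sigma>)"
proof -
  \<comment> \<open>The symmetric part of y x^T, since \<open>Pol_rank\<close> asks for symmetric
    matrices: its range lies in the span of \<open>x\<close> and \<open>y\<close>, and its pairing
    with a symmetric P is still <y, P x>.\<close>
  define M where "M = (1 / 2) *\<^sub>R (outer y x + outer x y)"
  have M: "symm_mat M"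
    by (simp add: symm_mat_def M_def outer_def transpose_def vec_eq_iff)
  have "M *v v = (1 / 2) *\<^sub>R ((x \<bullet> v) *\<^sub>R y + (y \<bullet> v) *\<^sub>R x)" for v
    unfolding M_def scaleR_matrix_vector_assoc[symmetric] matrix_vector_mult_add_rdistrib outer_mult_vec ..
  then have "M *v v \<in> span {x, y}" for v
    by (simp only:) (intro span_add span_scale span_base; simp)
  then have "range ((*v) M) \<subseteq> span {x, y}" by blast
  then have "rank M \<le> card {x, y}"
    unfolding rank_dim_range by (rule dim_le_card) simp
  also have "\<dots> \<le> 2" by (simp add: card_insert_if)
  finally have "(\<lambda>P. minner M P ^ t) \<in> Pol_rank l t"
    unfolding Pol_rank_def using M \<open>2 \<le> l\<close> by (auto intro!: exI[of _ "[(1, M, t)]"])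
  moreover have "\<forall>f\<in>Pol_rank l t. (\<Sum>(P, w)\<leftarrow>cub. w * f P) = integral\<^sup>L \<sigma> f"
    using cub by (simp add: exact_cubature_def)
  ultimately have ex: "(\<Sum>(P, w)\<leftarrow>cub. w * minner M P ^ t) = (\<integral>P. minner M P ^ t \<partial>\<sigma>)"
    by (rule bspec[rotated])
  have eq: "minner M P = y \<bullet> (P *v x)" if "P \<in> grass k" for P
  proof -
    have "x \<bullet> (P *v y) = y \<bullet> (P *v x)"
      by (metis dot_lmul_matrix grassD(2)[OF that] inner_commute transpose_matrix_vector)
    then show ?thesis
      by (simp add: minner_eq_inner[OF M]) (simp add: M_def inner_add_left inner_outer)
  qed
  have "(\<Sum>(P, w)\<leftarrow>cub. w * (y \<bullet> (P *v x)) ^ t) = (\<Sum>(P, w)\<leftarrow>cub. w * minner M P ^ t)"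
    using cub unfolding exact_cubature_def by (intro arg_cong[of _ _ sum_list] map_cong) (auto simp: eq)
  also have "\<dots> = (\<integral>P. (y \<bullet> (P *v x)) ^ t \<partial>\<sigma>)"
    unfolding ex
  proof (rule integral_cong_AE)
    show "AE P in \<sigma>. minner M P ^ t = (y \<bullet> (P *v x)) ^ t"
      using AE_grass[OF \<sigma>] by eventually_elim (simp add: eq)
  qed (auto simp: minner_eq_inner[OF M] inner_outer[symmetric] intro!: borel_measurable_integrable
      integrable_grass_measure[OF \<sigma>] continuous_on_inner_power)
  finally show ?thesis .
qed

text \<open>\<open>polynomial_eq_averaged_powers\<close> is applied to a single word spelling the
  monomial. Expanding the same combination of powers <y, z>^t in z yields \<open>a\<close>; putting
  z = P x and averaging over P recovers the monomial.\<close>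

lemma vpow_eq_averaged_powers:
  fixes \<sigma> :: "'d::finite mat measure"
  assumes \<sigma>: "grass_measure k \<sigma>" and "1 \<le> k" and \<alpha>: "mi_deg \<alpha> = t"
  shows "\<exists>(L :: (real \<times> (real^'d)) list) a.
    (\<forall>x. vpow x \<alpha> = (\<Sum>(c, y)\<leftarrow>L. c * (\<integral>P. (y \<bullet> (P *v x)) ^ t \<partial>\<sigma>))) \<and>
    (\<forall>z. (\<Sum>(c, y)\<leftarrow>L. c * (y \<bullet> z) ^ t) = (\<Sum>\<beta> | mi_deg \<beta> = t. a \<beta> * vpow z \<beta>))"
proof -
  obtain v where v: "v \<in> words t" "\<And>z. word_monom t z v = (\<Prod>i\<in>UNIV. z i ^ \<alpha> i)"
    using monomial_eq_word_monom[OF \<alpha>[unfolded mi_deg_def]] by auto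
  obtain L :: "(real \<times> (real^'d)) list" where L: "\<And>x. (\<Sum>w\<in>words t. of_bool (w = v) * word_monom t (($) x) w) =
      (\<Sum>(c, y)\<leftarrow>L. c * (\<integral>P. (y \<bullet> (P *v x)) ^ t \<partial>\<sigma>))"
    using polynomial_eq_averaged_powers[OF assms(1,2), where t = t and e = "\<lambda>w. of_bool (w = v)"] by blast
  have mono: "(\<Sum>w\<in>words t. of_bool (w = v) * word_monom t (($) x) w) = vpow x \<alpha>" for x
  proof -
    have "(\<Sum>w\<in>words t. of_bool (w = v) * word_monom t (($) x) w) = (\<Sum>w\<in>{v}. word_monom t (($) x) w)"
      using v(1) by (intro sum.mono_neutral_cong_right) auto
    then show ?thesis by (simp add: v(2) vpow_def)
  qed
  have 1: "vpow x \<alpha> = (\<Sum>(c, y)\<leftarrow>L. c * (\<integral>P. (y \<bullet> (P *v x)) ^ t \<partial>\<sigma>))" for x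
    by (rule trans[OF mono[symmetric] L])
  define b where "b w = (\<Sum>(c, y)\<leftarrow>L. c * word_monom t (($) y) w)" for w
  have 2: "(\<Sum>(c, y)\<leftarrow>L. c * (y \<bullet> z) ^ t) =
      (\<Sum>\<beta> | mi_deg \<beta> = t. (\<Sum>w | w \<in> words t \<and> word_count t w = \<beta>. b w) * vpow z \<beta>)" for z
  proof -
    have "(\<Sum>(c, y)\<leftarrow>L. c * (y \<bullet> z) ^ t) =
        (\<Sum>(c, y)\<leftarrow>L. c * (\<Sum>w\<in>words t. word_monom t (($) z) w * word_monom t (($) y) w))"
      unfolding sum_word_monom_mult by (simp add: inner_vec_def mult.commute)
    also have "\<dots> = (\<Sum>w\<in>words t. b w * word_monom t (($) z) w)"
      unfolding sum_list_pair_sum b_def by (intro sum.cong refl mult.commute)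
    also have "\<dots> = (\<Sum>\<beta> | mi_deg \<beta> = t. (\<Sum>w | w \<in> words t \<and> word_count t w = \<beta>. b w) * vpow z \<beta>)"
      unfolding vpow_def mi_deg_def by (rule sum_words_collect)
    finally show ?thesis .
  qed
  show ?thesis by (intro exI conjI allI) (rule 1, rule 2)
qed

section \<open>Integration over the distribution of the random vector\<close>

lemma abs_vpow_le: "\<bar>vpow z \<beta>\<bar> \<le> norm z ^ mi_deg \<beta>"
proof -
  have "\<bar>z $ i ^ \<beta> i\<bar> \<le> norm z ^ \<beta> i" for i
    unfolding power_abs by (intro power_mono component_le_norm_cart abs_ge_zero)
  then show ?thesis
    unfolding vpow_def abs_prod mi_deg_def power_sum by (intro prod_mono) simp
qed

lemma continuous_on_vpow_mult: "continuous_on UNIV (\<lambda>x. vpow (P *v x) \<beta>)"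
  for P :: "real^'n^'m"
  unfolding vpow_def by (intro continuous_intros)

text \<open>With the operator norm, the monomial at P x is at most (|P| |x|)^t, so the t-th absolute
  moment dominates.\<close>

lemma integrable_vpow_mult:
  fixes \<mu> :: "(real^'n) measure" and P :: "real^'n^'m"
  assumes \<mu>: "sets \<mu> = sets borel" "integrable \<mu> (\<lambda>x. norm x ^ t)" and "mi_deg \<beta> = t"
  shows "integrable \<mu> (\<lambda>x. vpow (P *v x) \<beta>)"
proof (rule Bochner_Integration.integrable_bound)
  show "integrable \<mu> (\<lambda>x. onorm ((*v) P) ^ t * norm x ^ t)" using \<mu> by simp
  have "(\<lambda>x. vpow (P *v x) \<beta>) \<in> borel_measurable borel"
    by (rule borel_measurable_continuous_onI[OF continuous_on_vpow_mult])
  then show "(\<lambda>x. vpow (P *v x) \<beta>) \<in> borel_measurable \<mu>"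
    using \<mu>(1) by (simp cong: measurable_cong_sets)
  have "\<bar>vpow (P *v x) \<beta>\<bar> \<le> (onorm ((*v) P) * norm x) ^ t" for x
    using abs_vpow_le[of "P *v x" \<beta>] assms(3)
      power_mono[OF onorm[OF matrix_vector_mul_bounded_linear[of P], of x], of t]
    by simp
  then show "AE x in \<mu>. norm (vpow (P *v x) \<beta>) \<le> norm (onorm ((*v) P) ^ t * norm x ^ t)"
    by (simp add: power_mult_distrib onorm_pos_le[OF matrix_vector_mul_bounded_linear[of P]] order_trans[OF _ abs_ge_self])
qed

lemma integral_cubature_sum:
  fixes g :: "'p \<Rightarrow> 'x \<Rightarrow> real"
  assumes "\<And>P. integrable \<mu> (g P)"
  shows "integrable \<mu> (\<lambda>x. \<Sum>(P, w)\<leftarrow>cub. w * g P x) \<and>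
    (\<integral>x. (\<Sum>(P, w)\<leftarrow>cub. w * g P x) \<partial>\<mu>) = (\<Sum>(P, w)\<leftarrow>cub. w * (\<integral>x. g P x \<partial>\<mu>))"
  using assms by (induction cub) auto

lemma sum_cubature_sum_swap:
  fixes I :: "'p \<Rightarrow> 'b \<Rightarrow> real"
  shows "(\<Sum>b\<in>B. a b * (\<Sum>(P, w)\<leftarrow>cub. w * I P b)) = (\<Sum>(P, w)\<leftarrow>cub. w * (\<Sum>b\<in>B. a b * I P b))"
  by (induction cub) (auto simp: sum_distrib_left sum.distrib algebra_simps)

lemma sum_cubature_sum_list_swap:
  fixes I :: "'p \<Rightarrow> 'y \<Rightarrow> real"
  shows "(\<Sum>(P, w)\<leftarrow>cub. w * (\<Sum>(c, y)\<leftarrow>L. c * I P y)) = (\<Sum>(c, y)\<leftarrow>L. c * (\<Sum>(P, w)\<leftarrow>cub. w * I P y))"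
proof (induction L)
  case Nil
  show ?case by (induction cub) auto
next
  case (Cons p L)
  have "(\<Sum>(P, w)\<leftarrow>cub. w * (c * I P y + R P)) = c * (\<Sum>(P, w)\<leftarrow>cub. w * I P y) + (\<Sum>(P, w)\<leftarrow>cub. w * R P)"
    for c y and R :: "'p \<Rightarrow> real"
    by (induction cub) (auto simp: algebra_simps)
  with Cons show ?case by (cases p) simp
qed

text \<open>The pointwise error bound is integrated; all sums are finite and commute with the
  expectation.\<close>

lemma moment_error_le:
  fixes \<mu> :: "(real^'d::finite) measure" and cub :: "('d mat \<times> real) list"
  assumes \<mu>: "sets \<mu> = sets borel" "integrable \<mu> (\<lambda>x. norm x ^ t)"
    and "mi_deg \<alpha> = t"
    and le: "\<And>x. \<bar>vpow x \<alpha> - (\<Sum>(P, w)\<leftarrow>cub. w * (\<Sum>\<beta> | mi_deg \<beta> = t. a \<beta> * vpow (P *v x) \<beta>))\<bar> \<le> B * norm x ^ t"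
  shows "\<bar>(\<integral>x. vpow x \<alpha> \<partial>\<mu>) -
      (\<Sum>\<beta> | mi_deg \<beta> = t. a \<beta> * (\<Sum>(P, w)\<leftarrow>cub. w * (\<integral>x. vpow (P *v x) \<beta> \<partial>\<mu>)))\<bar>
    \<le> B * (\<integral>x. norm x ^ t \<partial>\<mu>)"
proof -
  define g where "g P x = (\<Sum>\<beta> | mi_deg \<beta> = t. a \<beta> * vpow (P *v x) \<beta>)" for P :: "real^'d^'d" and x
  have int: "integrable \<mu> (\<lambda>x. vpow (P *v x) \<beta>)" if "mi_deg \<beta> = t" for P :: "real^'d^'d" and \<beta>
    by (rule integrable_vpow_mult[OF \<mu> that])
  \<comment> \<open>The identity matrix in place of \<open>P\<close> gives the plain
    monomial.\<close>
  have int\<alpha>: "integrable \<mu> (\<lambda>x. vpow x \<alpha>)" using int[of \<alpha> "mat 1"] assms(3) by simp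
  have g: "integrable \<mu> (g P)" "(\<integral>x. g P x \<partial>\<mu>) = (\<Sum>\<beta> | mi_deg \<beta> = t. a \<beta> * (\<integral>x. vpow (P *v x) \<beta> \<partial>\<mu>))" for P
    unfolding g_def using int by (auto intro!: Bochner_Integration.integrable_sum simp: Bochner_Integration.integral_sum)
  note cs = integral_cubature_sum[where \<mu> = \<mu> and g = g and cub = cub, OF g(1)]
  have "(\<Sum>\<beta> | mi_deg \<beta> = t. a \<beta> * (\<Sum>(P, w)\<leftarrow>cub. w * (\<integral>x. vpow (P *v x) \<beta> \<partial>\<mu>))) =
      (\<integral>x. (\<Sum>(P, w)\<leftarrow>cub. w * g P x) \<partial>\<mu>)"
    unfolding sum_cubature_sum_swap using cs by (simp add: g(2))
  then have "\<bar>(\<integral>x. vpow x \<alpha> \<partial>\<mu>) - (\<Sum>\<beta> | mi_deg \<beta> = t. a \<beta> * (\<Sum>(P, w)\<leftarrow>cub. w * (\<integral>x. vpow (P *v x) \<beta> \<partial>\<mu>)))\<bar> =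
      \<bar>\<integral>x. vpow x \<alpha> - (\<Sum>(P, w)\<leftarrow>cub. w * g P x) \<partial>\<mu>\<bar>"
    using int\<alpha> cs by (simp add: Bochner_Integration.integral_diff)
  also have "\<dots> \<le> (\<integral>x. \<bar>vpow x \<alpha> - (\<Sum>(P, w)\<leftarrow>cub. w * g P x)\<bar> \<partial>\<mu>)"
    by (rule integral_abs_bound)
  also have "\<dots> \<le> (\<integral>x. B * norm x ^ t \<partial>\<mu>)"
    using int\<alpha> cs \<mu>(2) le by (intro integral_mono) (auto simp: g_def)
  finally show ?thesis by simp
qed

text \<open>One list \<open>L\<close> serves both claims: exact cubatures integrate each <y, P x>^t
  without error, approximate ones with error at most \<epsilon> |y|^t |x|^t. \<open>a\<close> and
  \<open>C\<close> are read off from \<open>L\<close>, hence independent of the cubature and of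
  \<open>\<mu>\<close>.\<close>

lemma moment_formula:
  fixes \<sigma> :: "'d::finite mat measure"
  assumes \<sigma>: "grass_measure k \<sigma>" and k: "1 \<le> k" and \<alpha>: "mi_deg \<alpha> = t"
  shows "\<exists>a C. 0 \<le> C \<and>
    (\<forall>l cub (\<mu> :: (real^'d) measure).
       2 \<le> l \<and> exact_cubature k \<sigma> (Pol_rank l t) cub \<and> sets \<mu> = sets borel \<and>
       integrable \<mu> (\<lambda>x. norm x ^ t) \<longrightarrow>
       (\<integral>x. vpow x \<alpha> \<partial>\<mu>) =
         (\<Sum>\<beta> | mi_deg \<beta> = t. a \<beta> * (\<Sum>(P, w)\<leftarrow>cub. w * (\<integral>x. vpow (P *v x) \<beta> \<partial>\<mu>)))) \<and>
    (\<forall>\<epsilon> cub (\<mu> :: (real^'d) measure).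
       approx_cubature \<epsilon> t k \<sigma> cub \<and> sets \<mu> = sets borel \<and> integrable \<mu> (\<lambda>x. norm x ^ t) \<longrightarrow>
       \<bar>(\<integral>x. vpow x \<alpha> \<partial>\<mu>) -
         (\<Sum>\<beta> | mi_deg \<beta> = t. a \<beta> * (\<Sum>(P, w)\<leftarrow>cub. w * (\<integral>x. vpow (P *v x) \<beta> \<partial>\<mu>)))\<bar>
       \<le> C * \<epsilon> * (\<integral>x. norm x ^ t \<partial>\<mu>))"
proof -
  obtain L :: "(real \<times> (real^'d)) list" and a where
    L: "\<forall>x. vpow x \<alpha> = (\<Sum>(c, y)\<leftarrow>L. c * (\<integral>P. (y \<bullet> (P *v x)) ^ t \<partial>\<sigma>))" and
    a: "\<forall>z. (\<Sum>(c, y)\<leftarrow>L. c * (y \<bullet> z) ^ t) = (\<Sum>\<beta> | mi_deg \<beta> = t. a \<beta> * vpow z \<beta>)"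
    using vpow_eq_averaged_powers[OF assms] by (elim exE conjE)
  \<comment> \<open>A list entry (c, y) contributes an error of at most |c| |y|^t \<epsilon>
    |x|^t.\<close>
  define C where "C = (\<Sum>(c, y)\<leftarrow>L. \<bar>c\<bar> * norm y ^ t)"
  have C: "0 \<le> C" unfolding C_def by (intro sum_list_nonneg) auto
  have cubsum: "(\<Sum>(P, w)\<leftarrow>cub. w * (\<Sum>\<beta> | mi_deg \<beta> = t. a \<beta> * vpow (P *v x) \<beta>)) =
      (\<Sum>(c, y)\<leftarrow>L. c * (\<Sum>(P, w)\<leftarrow>cub. w * (y \<bullet> (P *v x)) ^ t))" for cub :: "('d mat \<times> real) list" and x
    unfolding a[rule_format, symmetric] by (rule sum_cubature_sum_list_swap)
  have exact: "(\<integral>x. vpow x \<alpha> \<partial>\<mu>) =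
      (\<Sum>\<beta> | mi_deg \<beta> = t. a \<beta> * (\<Sum>(P, w)\<leftarrow>cub. w * (\<integral>x. vpow (P *v x) \<beta> \<partial>\<mu>)))"
    if "2 \<le> l" "exact_cubature k \<sigma> (Pol_rank l t) cub" "sets \<mu> = sets borel"
      "integrable \<mu> (\<lambda>x. norm x ^ t)" for l cub and \<mu> :: "(real^'d) measure"
  proof -
    \<comment> \<open>Exactness is \<open>moment_error_le\<close> with B = 0.\<close>
    have "\<bar>(\<integral>x. vpow x \<alpha> \<partial>\<mu>) -
        (\<Sum>\<beta> | mi_deg \<beta> = t. a \<beta> * (\<Sum>(P, w)\<leftarrow>cub. w * (\<integral>x. vpow (P *v x) \<beta> \<partial>\<mu>)))\<bar>
        \<le> 0 * (\<integral>x. norm x ^ t \<partial>\<mu>)"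
      by (rule moment_error_le[OF that(3,4) \<alpha>])
        (simp add: cubsum L[rule_format] exact_cubature_inner_power[OF \<sigma> that(2,1)])
    then show ?thesis by simp
  qed
  have approx: "\<bar>(\<integral>x. vpow x \<alpha> \<partial>\<mu>) -
      (\<Sum>\<beta> | mi_deg \<beta> = t. a \<beta> * (\<Sum>(P, w)\<leftarrow>cub. w * (\<integral>x. vpow (P *v x) \<beta> \<partial>\<mu>)))\<bar>
      \<le> C * \<epsilon> * (\<integral>x. norm x ^ t \<partial>\<mu>)"
    if "approx_cubature \<epsilon> t k \<sigma> cub" "sets \<mu> = sets borel"
      "integrable \<mu> (\<lambda>x. norm x ^ t)" for \<epsilon> cub and \<mu> :: "(real^'d) measure"
  proof (rule moment_error_le[OF that(2,3) \<alpha>])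
    fix x :: "real^'d"
    \<comment> \<open>The matrix y x^T has pairing <y, P x> with P and Frobenius norm |y|
      |x|.\<close>
    have one: "\<bar>(\<integral>P. (y \<bullet> (P *v x)) ^ t \<partial>\<sigma>) - (\<Sum>(P, w)\<leftarrow>cub. w * (y \<bullet> (P *v x)) ^ t)\<bar> \<le> norm y ^ t * (\<epsilon> * norm x ^ t)" for y
      using approx_cubature_inner_power[OF \<sigma> k that(1), of "outer y x"]
      by (simp add: inner_outer norm_outer power_mult_distrib abs_minus_commute ac_simps)
    have "\<bar>(\<Sum>(c, y)\<leftarrow>L. c * I y) - (\<Sum>(c, y)\<leftarrow>L. c * J y)\<bar> \<le> (\<Sum>(c, y)\<leftarrow>L. \<bar>c\<bar> * norm y ^ t) * (\<epsilon> * norm x ^ t)"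
      if IJ: "\<And>y. \<bar>I y - J y\<bar> \<le> norm y ^ t * (\<epsilon> * norm x ^ t)" for I J :: "real^'d \<Rightarrow> real"
    proof (induction L)
      case (Cons p L)
      obtain c y where p: "p = (c, y)" by (cases p)
      have "\<bar>c * I y - c * J y\<bar> \<le> \<bar>c\<bar> * norm y ^ t * (\<epsilon> * norm x ^ t)"
        using mult_left_mono[OF IJ[of y], of "\<bar>c\<bar>"] by (simp add: abs_mult mult.assoc flip: right_diff_distrib)
      then show ?case using Cons by (simp add: p distrib_right)
    qed simp
    from this[OF one] show "\<bar>vpow x \<alpha> - (\<Sum>(P, w)\<leftarrow>cub. w * (\<Sum>\<beta> | mi_deg \<beta> = t. a \<beta> * vpow (P *v x) \<beta>))\<bar> \<le> C * \<epsilon> * norm x ^ t"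
      unfolding cubsum L[rule_format] C_def by (simp add: mult.assoc)
  qed
  show ?thesis
    by (intro exI[of _ a] exI[of _ C] conjI C allI impI; elim conjE) (rule exact approx; assumption)+
qed

section \<open>Random vectors on the sphere, and the two statements\<close>

text \<open>Almost surely |x| = 1, which supplies the moment condition and turns the factor E|X|^t
  of the error bound into 1.\<close>

lemma norm_power_of_sphere:
  fixes \<mu> :: "(real^'d::finite) measure"
  assumes "prob_space \<mu>" "sets \<mu> = sets borel" "emeasure \<mu> (sphere 0 1) = 1"
  shows "integrable \<mu> (\<lambda>x. norm x ^ t)" "(\<integral>x. norm x ^ t \<partial>\<mu>) = 1"
proof -
  interpret prob_space \<mu> by fact
  have "AE x in \<mu>. x \<in> sphere 0 1"
    using assms by (subst AE_in_set_eq_1) (auto simp: emeasure_eq_measure)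
  then have AE: "AE x in \<mu>. norm x ^ t = 1" by eventually_elim simp
  have [measurable]: "(\<lambda>x. norm x ^ t) \<in> borel_measurable \<mu>"
    using assms(2) by (simp cong: measurable_cong_sets)
  show "integrable \<mu> (\<lambda>x. norm x ^ t)"
    by (rule integrable_const_bound[of _ 1]) (use AE in auto)
  have "(\<integral>x. norm x ^ t \<partial>\<mu>) = (\<integral>x. 1 \<partial>\<mu>)"
    by (rule integral_cong_AE) (use AE in auto)
  then show "(\<integral>x. norm x ^ t \<partial>\<mu>) = 1" by (simp add: prob_space)
qed

lemma sum_mi_deg_extend:
  "(\<Sum>\<beta>\<in>{\<beta>. mi_deg \<beta> \<le> t}. (if mi_deg \<beta> = t then a \<beta> else 0) * F \<beta>) = (\<Sum>\<beta> | mi_deg \<beta> = t. a \<beta> * F \<beta>)"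
  for a F :: "('d::finite \<Rightarrow> nat) \<Rightarrow> real"
  by (rule sum.mono_neutral_cong_right) (auto simp: mi_deg_def finite_sum_le)

theorem theorem6p1:
  shows
  "(\<forall>k t (\<sigma> :: ('d::finite) mat measure) (\<alpha> :: 'd \<Rightarrow> nat).
      1 \<le> k \<and> k < CARD('d) \<and> 1 \<le> t \<and> grass_measure k \<sigma> \<and> mi_deg \<alpha> = t \<longrightarrow>
      (\<exists>(a :: ('d \<Rightarrow> nat) \<Rightarrow> real) (c :: real). c \<ge> 0 \<and>
         (\<forall>cub (\<mu> :: (real^'d) measure).
            exact_cubature k \<sigma> (Pol_rank 2 t) cub \<and>
            prob_space \<mu> \<and> sets \<mu> = sets borel \<and> emeasure \<mu> (sphere 0 1) = 1 \<longrightarrow>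
            (\<integral>x. vpow x \<alpha> \<partial>\<mu>) =
              (\<Sum>\<beta>\<in>{\<beta>. mi_deg \<beta> \<le> t}. a \<beta> * (\<Sum>(P, w)\<leftarrow>cub. w * (\<integral>x. vpow (P *v x) \<beta> \<partial>\<mu>)))) \<and>
         (\<forall>\<epsilon> cub (\<mu> :: (real^'d) measure).
            \<epsilon> \<ge> 0 \<and> approx_cubature \<epsilon> t k \<sigma> cub \<and>
            prob_space \<mu> \<and> sets \<mu> = sets borel \<and> emeasure \<mu> (sphere 0 1) = 1 \<longrightarrow>
            \<bar>(\<integral>x. vpow x \<alpha> \<partial>\<mu>) -
              (\<Sum>\<beta>\<in>{\<beta>. mi_deg \<beta> \<le> t}. a \<beta> * (\<Sum>(P, w)\<leftarrow>cub. w * (\<integral>x. vpow (P *v x) \<beta> \<partial>\<mu>)))\<bar>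
              \<le> \<epsilon> * c)))
   \<and>
   (\<forall>t (\<sigma> :: ('d::finite) mat measure) (\<alpha> :: 'd \<Rightarrow> nat).
      1 < CARD('d) \<and> 1 \<le> t \<and> t \<le> CARD('d) \<and> grass_measure 1 \<sigma> \<and> mi_deg \<alpha> = t \<longrightarrow>
      (\<exists>(a :: ('d \<Rightarrow> nat) \<Rightarrow> real) (c :: real). c \<ge> 0 \<and>
         (\<forall>cub (\<mu> :: (real^'d) measure).
            exact_cubature 1 \<sigma> (Pol_rank 3 t) cub \<and>
            prob_space \<mu> \<and> sets \<mu> = sets borel \<and> integrable \<mu> (\<lambda>x. norm x ^ t) \<longrightarrow>
            (\<integral>x. vpow x \<alpha> \<partial>\<mu>) =
              (\<Sum>\<beta>\<in>{\<beta>. mi_deg \<beta> = t}. a \<beta> * (\<Sum>(P, w)\<leftarrow>cub. w * (\<integral>x. vpow (P *v x) \<beta> \<partial>\<mu>)))) \<and>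
         (\<forall>\<epsilon> cub (\<mu> :: (real^'d) measure).
            approx_cubature \<epsilon> t 1 \<sigma> cub \<and>
            prob_space \<mu> \<and> sets \<mu> = sets borel \<and> integrable \<mu> (\<lambda>x. norm x ^ t) \<longrightarrow>
            \<bar>(\<integral>x. vpow x \<alpha> \<partial>\<mu>) -
              (\<Sum>\<beta>\<in>{\<beta>. mi_deg \<beta> = t}. a \<beta> * (\<Sum>(P, w)\<leftarrow>cub. w * (\<integral>x. vpow (P *v x) \<beta> \<partial>\<mu>)))\<bar>
              \<le> c * \<epsilon> * (\<integral>x. norm x ^ t \<partial>\<mu>))))"
proof (intro conjI allI impI, goal_cases)
  case (1 k t \<sigma> \<alpha>)
  then have \<sigma>: "grass_measure k \<sigma>" "1 \<le> k" "mi_deg \<alpha> = t" by auto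
  obtain a C where C: "0 \<le> C" and
    exact: "\<And>l cub \<mu>. 2 \<le> l \<Longrightarrow> exact_cubature k \<sigma> (Pol_rank l t) cub \<Longrightarrow> sets \<mu> = sets borel \<Longrightarrow>
       integrable \<mu> (\<lambda>x. norm x ^ t) \<Longrightarrow>
       (\<integral>x. vpow x \<alpha> \<partial>\<mu>) =
         (\<Sum>\<beta> | mi_deg \<beta> = t. a \<beta> * (\<Sum>(P, w)\<leftarrow>cub. w * (\<integral>x. vpow (P *v x) \<beta> \<partial>\<mu>)))" and
    approx: "\<And>\<epsilon> cub \<mu>. approx_cubature \<epsilon> t k \<sigma> cub \<Longrightarrow> sets \<mu> = sets borel \<Longrightarrow>
       integrable \<mu> (\<lambda>x. norm x ^ t) \<Longrightarrow>
       \<bar>(\<integral>x. vpow x \<alpha> \<partial>\<mu>) -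
         (\<Sum>\<beta> | mi_deg \<beta> = t. a \<beta> * (\<Sum>(P, w)\<leftarrow>cub. w * (\<integral>x. vpow (P *v x) \<beta> \<partial>\<mu>)))\<bar>
       \<le> C * \<epsilon> * (\<integral>x. norm x ^ t \<partial>\<mu>)"
    using moment_formula[OF \<sigma>] by (elim exE conjE) simp
  \<comment> \<open>Coefficients below degree t are set to 0, so the sum over all degrees up to t
    reduces to degree t.\<close>
  show ?case
  proof (intro exI[of _ "\<lambda>\<beta>. if mi_deg \<beta> = t then a \<beta> else 0"] exI[of _ C] conjI allI impI C,
      unfold sum_mi_deg_extend, goal_cases)
    case (1 cub \<mu>)
    then show ?case by (intro exact[of 2]) (simp_all add: norm_power_of_sphere)
  next
    case (2 \<epsilon> cub \<mu>)
    then show ?case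
      using approx[of \<epsilon> cub \<mu>] by (simp add: norm_power_of_sphere mult.commute)
  qed
next
  case (2 t \<sigma> \<alpha>)
  then have \<sigma>: "grass_measure 1 \<sigma>" "1 \<le> (1::nat)" "mi_deg \<alpha> = t" by auto
  obtain a C where C: "0 \<le> C" and
    exact: "\<And>l cub \<mu>. 2 \<le> l \<Longrightarrow> exact_cubature 1 \<sigma> (Pol_rank l t) cub \<Longrightarrow> sets \<mu> = sets borel \<Longrightarrow>
       integrable \<mu> (\<lambda>x. norm x ^ t) \<Longrightarrow>
       (\<integral>x. vpow x \<alpha> \<partial>\<mu>) =
         (\<Sum>\<beta> | mi_deg \<beta> = t. a \<beta> * (\<Sum>(P, w)\<leftarrow>cub. w * (\<integral>x. vpow (P *v x) \<beta> \<partial>\<mu>)))" and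
    approx: "\<And>\<epsilon> cub \<mu>. approx_cubature \<epsilon> t 1 \<sigma> cub \<Longrightarrow> sets \<mu> = sets borel \<Longrightarrow>
       integrable \<mu> (\<lambda>x. norm x ^ t) \<Longrightarrow>
       \<bar>(\<integral>x. vpow x \<alpha> \<partial>\<mu>) -
         (\<Sum>\<beta> | mi_deg \<beta> = t. a \<beta> * (\<Sum>(P, w)\<leftarrow>cub. w * (\<integral>x. vpow (P *v x) \<beta> \<partial>\<mu>)))\<bar>
       \<le> C * \<epsilon> * (\<integral>x. norm x ^ t \<partial>\<mu>)"
    using moment_formula[OF \<sigma>] by (elim exE conjE) simp
  show ?case
  proof (intro exI[of _ a] exI[of _ C] conjI allI impI C, goal_cases)
    case (1 cub \<mu>)
    \<comment> \<open>The exact identity holds for every rank bound from 2 on, here for 3.\<close>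
    then show ?case by (intro exact[of 3]) simp_all
  next
    case (2 \<epsilon> cub \<mu>)
    then show ?case by (intro approx) simp_all
  qed
qed

end
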